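(* Let $E$ be an AL-space and let $\mathcal{S} = (S_t)_{t \in J}$ and $\mathcal{T} = (T_t)_{t \in J}$ be two bounded positive semigroups on $E$, where either $J = \mathbb{N}$ or $J = (0,\infty)$. Assume that $\mathcal{S}$ asymptotically dominates $\mathcal{T}$ in the sense that $\|(S_tf-T_tf)^-\| \to 0$ as $t \to \infty$ for all $f \in E_+$. If $\mathcal{T}$ is strongly convergent and its limit operator $P$ fulfils $\|Pf\| \ge \varepsilon \|f\|$ for all $f \in E_+$ and some $\varepsilon > 0$, then $\mathcal{S}$ is strongly convergent, too.
   Context: All spaces are real. $\mathbb{N} = \{1,2,\dots\}$. An AL-space is a Banach lattice $E$ with $\|f+g\| = \|f\|+\|g\|$ for all $f,g \in E_+$, where $E_+$ is the positive cone. A semigroup on $E$ is a family $(T_t)_{t \in J}$ of bounded linear operators on $E$ with $T_{t+s} = T_tT_s$ for all $s,t \in J$; no continuity in $t$ is assumed. It is bounded if $\sup_{t\in J}\|T_t\|<\infty$, and positive if $T_tE_+\subseteq E_+$ for all $t \in J$. $g^- = (-g)\vee 0$. Strongly convergent means convergent as $t\to\infty$ in the strong operator topology to a bounded linear operator. *)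

theory Defs
  imports "HOL-Analysis.Analysis" "HOL-Library.Lattice_Algebras"
begin

(* The class lattice_ab_group_add_abs supplies the lattice operations and
   the identity \<bar>f\<bar> = sup f (- f) for the modulus. *)
class banach_lattice = banach + ordered_real_vector + lattice_ab_group_add_abs +
  assumes norm_mono_abs: "\<bar>f\<bar> \<le> \<bar>g\<bar> \<Longrightarrow> norm f \<le> norm g"

class al_space = banach_lattice +
  assumes norm_add_nonneg: "0 \<le> f \<Longrightarrow> 0 \<le> g \<Longrightarrow> norm (f + g) = norm f + norm g"

(* The library's nprt f = inf f 0 is the negative of this. *)
definition neg_part :: "'a::lattice_ab_group_add \<Rightarrow> 'a" where
  "neg_part g = sup (- g) 0"

(* Both time domains are sets of reals; a semigroup is a function on the reals
   of which only the values on the time domain J are ever used. *)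
definition discrete_time :: "real set" where
  "discrete_time = {real n | n. 1 \<le> n}"

definition continuous_time :: "real set" where
  "continuous_time = {0<..}"

(* t tends to infinity within J *)
definition at_top_in :: "real set \<Rightarrow> real filter" where
  "at_top_in J = inf at_top (principal J)"

definition op_semigroup_on :: "real set \<Rightarrow> (real \<Rightarrow> 'a::real_normed_vector \<Rightarrow>\<^sub>L 'a) \<Rightarrow> bool" where
  "op_semigroup_on J T \<longleftrightarrow> (\<forall>t\<in>J. \<forall>s\<in>J. T (t + s) = T t o\<^sub>L T s)"

definition bounded_op_family :: "real set \<Rightarrow> (real \<Rightarrow> 'a::real_normed_vector \<Rightarrow>\<^sub>L 'a) \<Rightarrow> bool" where
  "bounded_op_family J T \<longleftrightarrow> bdd_above ((\<lambda>t. norm (T t)) ` J)"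

definition positive_op_family :: "real set \<Rightarrow> (real \<Rightarrow> 'a::banach_lattice \<Rightarrow>\<^sub>L 'a) \<Rightarrow> bool" where
  "positive_op_family J T \<longleftrightarrow> (\<forall>t\<in>J. \<forall>f\<ge>0. 0 \<le> blinfun_apply (T t) f)"

definition strong_limit ::
    "real set \<Rightarrow> (real \<Rightarrow> 'a::real_normed_vector \<Rightarrow>\<^sub>L 'a) \<Rightarrow> ('a \<Rightarrow>\<^sub>L 'a) \<Rightarrow> bool" where
  "strong_limit J T P \<longleftrightarrow>
     (\<forall>f. ((\<lambda>t. blinfun_apply (T t) f) \<longlongrightarrow> blinfun_apply P f) (at_top_in J))"

definition strongly_convergent ::
    "real set \<Rightarrow> (real \<Rightarrow> 'a::real_normed_vector \<Rightarrow>\<^sub>L 'a) \<Rightarrow> bool" where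
  "strongly_convergent J T \<longleftrightarrow> (\<exists>P. strong_limit J T P)"

definition asymptotically_dominates ::
    "real set \<Rightarrow> (real \<Rightarrow> 'a::banach_lattice \<Rightarrow>\<^sub>L 'a) \<Rightarrow> (real \<Rightarrow> 'a \<Rightarrow>\<^sub>L 'a) \<Rightarrow> bool" where
  "asymptotically_dominates J S T \<longleftrightarrow>
     (\<forall>f\<ge>0. ((\<lambda>t. norm (neg_part (blinfun_apply (S t) f - blinfun_apply (T t) f))) \<longlongrightarrow> 0)
       (at_top_in J))"

end

theory Submission
  imports Defs
begin

text \<open>
  The limit \<open>P\<close> of \<open>\<T>\<close> is positive and \<open>T t (P f) = P f\<close>, so the domination assumption gives two
  facts about \<open>\<S>\<close> alone, for every \<open>f \<ge> 0\<close>: asymptotically \<open>S t f\<close> lies above \<open>P f\<close>, and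
  asymptotically \<open>S t (P f)\<close> lies above \<open>P f\<close>. Together with \<open>\<epsilon> * norm f \<le> norm (P f)\<close> they force \<open>\<S>\<close>
  to converge; this is the lower bound theorem \<open>lower_bound_strongly_convergent\<close>.

  Two ideas carry that theorem. Both use that the norm is additive on the positive cone, so that
  an inequality between positive vectors whose norms are almost equal is almost an equality.

  First, let \<open>h = P f\<close>. Since \<open>S t h\<close> is asymptotically above \<open>h\<close>, applying \<open>S s\<close> shows that
  \<open>S (s + t) h\<close> is above \<open>S s h\<close> up to an error that is small uniformly in \<open>s\<close>. The orbit of \<open>h\<close> is
  thus almost increasing and it is norm bounded, so the additivity of the norm makes it a Cauchy
  net, as for an increasing bounded net (\<open>subinvariant_orbit_almost_constant\<close>).

  Secondly, let \<open>f \<ge> 0\<close> be arbitrary, with \<open>norm (S t f) \<le> L\<close> for all large \<open>t\<close>. Either the orbit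
  eventually stays below \<open>(1 - \<epsilon> / 4) * L\<close> in norm, or some \<open>u = S r f\<close> has norm close to \<open>L\<close>. In the
  second case \<open>S s u = P u + g\<close> for large \<open>s\<close>, up to a small error, with \<open>g \<ge> 0\<close>. The part \<open>P u\<close>
  has an almost constant orbit, whose norm stays above \<open>norm (P u)\<close> up to a small error and hence uses
  up a fixed fraction of \<open>L\<close>; by additivity only the rest of \<open>L\<close> is left for the orbit of \<open>g\<close>. Iterating,
  the part of the orbit of \<open>f\<close> whose convergence is still in doubt decreases geometrically
  (\<open>lower_bound_orbit_oscillation\<close>). So the orbit of \<open>f\<close> is a Cauchy net, and completeness yields the
  limit. General vectors are differences of positive ones.
\<close>

section \<open>Positive and negative parts in Banach lattices\<close>

lemma neg_part_nonneg: "0 \<le> neg_part (x::'a::lattice_ab_group_add)"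
  by (simp add: neg_part_def)

lemma pprt_minus_neg_part: "pprt x - neg_part x = (x::'a::lattice_ab_group_add)"
proof -
  have "neg_part x = - nprt x"
    by (simp add: neg_part_def nprt_def neg_inf_eq_sup)
  then show ?thesis
    using prts[of x] by simp
qed

lemma neg_part_add_le: "neg_part (x + y) \<le> neg_part x + neg_part (y::'a::lattice_ab_group_add)"
proof -
  have "- (x + y) \<le> neg_part x + neg_part y"
    using add_mono[of "- x" "neg_part x" "- y" "neg_part y"] by (simp add: neg_part_def add.commute)
  then show ?thesis
    by (metis add_nonneg_nonneg le_sup_iff neg_part_def neg_part_nonneg)
qed

lemma neg_part_le_abs: "neg_part x \<le> \<bar>x\<bar>" for x :: "'a::lattice_ab_group_add_abs"
  by (simp add: neg_part_def abs_ge_minus_self)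

lemma norm_mono_nonneg:
  fixes x y :: "'a::banach_lattice"
  assumes "0 \<le> x" "x \<le> y"
  shows "norm x \<le> norm y"
  using assms norm_mono_abs[of x y] by (metis abs_of_nonneg order_trans)

lemma norm_abs_lattice: "norm \<bar>x\<bar> = norm (x::'a::banach_lattice)"
  by (intro antisym norm_mono_abs) simp_all

lemma norm_neg_part_le: "norm (neg_part x) \<le> norm (x::'a::banach_lattice)"
  using norm_mono_nonneg[OF neg_part_nonneg neg_part_le_abs[of x]] by (simp add: norm_abs_lattice)

lemma norm_neg_part_add_le:
  "norm (neg_part (x + y)) \<le> norm (neg_part x) + norm (neg_part (y::'a::banach_lattice))"
  by (meson neg_part_add_le neg_part_nonneg norm_mono_nonneg norm_triangle_ineq order_trans)

text \<open>The positive cone is closed: \<open>0 \<le> x t\<close> gives \<open>- l \<le> \<bar>x t - l\<bar>\<close>, so the negative part of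
  the limit is at most \<open>\<bar>x t - l\<bar>\<close>.\<close>

lemma nonneg_limit:
  fixes x :: "'b \<Rightarrow> 'a::banach_lattice"
  assumes "F \<noteq> bot" "(x \<longlongrightarrow> l) F" "\<forall>\<^sub>F t in F. 0 \<le> x t"
  shows "0 \<le> l"
proof -
  have "((\<lambda>t. norm (x t - l)) \<longlongrightarrow> 0) F"
    using assms(2) by (simp add: tendsto_norm_zero LIM_zero)
  moreover have "\<forall>\<^sub>F t in F. norm (neg_part l) \<le> norm (x t - l)"
    using assms(3)
  proof eventually_elim
    case (elim t)
    have "- l \<le> x t - l" using elim by simp
    also have "\<dots> \<le> \<bar>x t - l\<bar>" by (rule abs_ge_self)
    finally have "neg_part l \<le> \<bar>x t - l\<bar>"
      by (simp add: neg_part_def)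
    then show ?case
      using norm_mono_nonneg[OF neg_part_nonneg] by (metis norm_abs_lattice)
  qed
  ultimately have "norm (neg_part l) \<le> 0"
    using assms(1) tendsto_lowerbound by blast
  then have "neg_part l = 0" by simp
  then show ?thesis
    using pprt_minus_neg_part[of l] zero_le_pprt[of l] by simp
qed

section \<open>Time tending to infinity\<close>

definition time_domain :: "real set \<Rightarrow> bool" where
  "time_domain J \<longleftrightarrow> J = discrete_time \<or> J = continuous_time"

lemma time_domain_add: "time_domain J \<Longrightarrow> s \<in> J \<Longrightarrow> t \<in> J \<Longrightarrow> s + t \<in> J"
  unfolding time_domain_def discrete_time_def continuous_time_def
  by (auto simp flip: of_nat_add)

lemma time_domain_diff:
  assumes "time_domain J" "s \<in> J" "t \<in> J" "s < t"
  shows "t - s \<in> J"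
  using assms(1) unfolding time_domain_def
proof
  assume J: "J = discrete_time"
  then obtain m n where "s = real m" "t = real n"
    using assms unfolding discrete_time_def by auto
  then have "t - s = real (n - m)" "1 \<le> n - m"
    using assms(4) by auto
  then show ?thesis
    unfolding J discrete_time_def by blast
qed (use assms in \<open>auto simp: continuous_time_def\<close>)

lemma time_domain_unbounded:
  assumes "time_domain J"
  obtains t where "t \<in> J" "N \<le> t"
proof -
  obtain n :: nat where "N \<le> real n" using real_arch_simple by blast
  then have "N \<le> real (Suc n)" by simp
  moreover have "real (Suc n) \<in> J"
    using assms unfolding time_domain_def discrete_time_def continuous_time_def
    by fastforce
  ultimately show ?thesis using that by blast
qed

lemma eventually_at_top_in: "eventually X (at_top_in J) \<longleftrightarrow> (\<exists>N. \<forall>t\<in>J. N \<le> t \<longrightarrow> X t)"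
  unfolding at_top_in_def eventually_inf_principal eventually_at_top_linorder by blast

lemma eventually_in_time: "\<forall>\<^sub>F t in at_top_in J. t \<in> J"
  by (auto simp: eventually_at_top_in)

lemma at_top_in_neq_bot: "time_domain J \<Longrightarrow> at_top_in J \<noteq> bot"
  unfolding trivial_limit_def eventually_at_top_in using time_domain_unbounded by metis

text \<open>Replacing \<open>f\<close> by \<open>S a f\<close> shifts its orbit by \<open>a\<close>; asymptotic properties of the orbit do not
  notice this, because every time beyond \<open>a\<close> is reached by the shift.\<close>

lemma eventually_time_shift:
  assumes J: "time_domain J" and a: "a \<in> J"
  shows "(\<forall>\<^sub>F t in at_top_in J. X (t + a)) \<longleftrightarrow> (\<forall>\<^sub>F t in at_top_in J. X t)"
proof
  assume "\<forall>\<^sub>F t in at_top_in J. X (t + a)"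
  then obtain N where N: "\<And>t. t \<in> J \<Longrightarrow> N \<le> t \<Longrightarrow> X (t + a)"
    by (auto simp: eventually_at_top_in)
  \<comment> \<open>The bound \<open>a + 1\<close> makes \<open>t - a\<close> strictly positive, as membership in the time domain requires.\<close>
  have "X t" if "t \<in> J" "max (N + a) (a + 1) \<le> t" for t
    using N[of "t - a"] time_domain_diff[OF J a, of t] that by simp
  then show "\<forall>\<^sub>F t in at_top_in J. X t"
    unfolding eventually_at_top_in by blast
next
  assume "\<forall>\<^sub>F t in at_top_in J. X t"
  then obtain N where N: "\<And>t. t \<in> J \<Longrightarrow> N \<le> t \<Longrightarrow> X t"
    by (auto simp: eventually_at_top_in)
  have "X (t + a)" if "t \<in> J" "N - a \<le> t" for t
    using N[of "t + a"] time_domain_add[OF J _ a] that by simp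
  then show "\<forall>\<^sub>F t in at_top_in J. X (t + a)"
    unfolding eventually_at_top_in by blast
qed

lemma eventually_small:
  assumes "((\<lambda>t. norm (x t)) \<longlongrightarrow> 0) F" "0 < (\<delta>::real)"
  shows "\<forall>\<^sub>F t in F. norm (x t) \<le> \<delta>"
  using order_tendstoD(2)[OF assms] by eventually_elim simp

section \<open>Orbits of bounded positive semigroups on AL-spaces\<close>

locale bounded_positive_semigroup =
  fixes J :: "real set" and S :: "real \<Rightarrow> 'a::al_space \<Rightarrow>\<^sub>L 'a" and M :: real
  assumes J: "time_domain J"
    and semigroup: "\<And>s t. s \<in> J \<Longrightarrow> t \<in> J \<Longrightarrow> S (s + t) = S s o\<^sub>L S t"
    and bound: "\<And>t. t \<in> J \<Longrightarrow> norm (S t) \<le> M"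
    and positive: "\<And>t f. t \<in> J \<Longrightarrow> 0 \<le> f \<Longrightarrow> 0 \<le> S t f"
begin

lemma apply_add: "s \<in> J \<Longrightarrow> t \<in> J \<Longrightarrow> S (s + t) x = S s (S t x)"
  by (simp add: semigroup)

lemma norm_apply_le: "t \<in> J \<Longrightarrow> norm (S t x) \<le> M * norm x"
  by (meson bound mult_right_mono norm_blinfun norm_ge_zero order_trans)

lemma M_nonneg: "0 \<le> M"
  using time_domain_unbounded[OF J] by (metis bound norm_ge_zero order_trans)

text \<open>The orbit is almost increasing: \<open>S (t + s) h - S s h\<close> is \<open>S s\<close> applied to the difference
  \<open>S t h - h\<close>, whose negative part is small for large \<open>t\<close>. By additivity of the norm, the increase
  from \<open>S s h\<close> to \<open>S (t + s) h\<close> has, up to this error, the norm \<open>norm (S (t + s) h) - norm (S s h)\<close>.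
  If \<open>norm (S s h)\<close> is close to the supremum of the norms along the orbit, there is no room left for
  an increase, and the orbit stays close to \<open>S s h\<close>.\<close>

lemma subinvariant_orbit_almost_constant:
  assumes h: "0 \<le> h"
    and sub: "((\<lambda>t. norm (neg_part (S t h - h))) \<longlongrightarrow> 0) (at_top_in J)"
    and \<kappa>: "0 < \<kappa>"
  shows "\<exists>c. \<forall>\<^sub>F t in at_top_in J. norm (S t h - c) \<le> \<kappa>"
proof -
  define A where "A = (\<lambda>s. norm (S s h)) ` J"
  have bdd: "bdd_above A"
    unfolding A_def using norm_apply_le by (intro bdd_aboveI2)
  have "A \<noteq> {}"
    unfolding A_def using time_domain_unbounded[OF J] by blast
  moreover have "Sup A - \<kappa> / 2 < Sup A"
    using \<kappa> by simp
  ultimately obtain y where "y \<in> A" "Sup A - \<kappa> / 2 < y"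
    using less_cSupE by blast
  then obtain s where s: "s \<in> J" "Sup A - \<kappa> / 2 < norm (S s h)"
    unfolding A_def by blast
  \<comment> \<open>The denominator has \<open>M + 1\<close> instead of \<open>M\<close> because \<open>M\<close> may be \<open>0\<close>.\<close>
  define \<delta> where "\<delta> = \<kappa> / (4 * (M + 1))"
  have \<delta>: "0 < \<delta>"
    using \<kappa> M_nonneg by (simp add: \<delta>_def)
  have M\<delta>: "M * \<delta> \<le> \<kappa> / 4"
    using \<kappa> M_nonneg by (simp add: \<delta>_def field_simps)
  have "\<forall>\<^sub>F t in at_top_in J. norm (S (t + s) h - S s h) \<le> \<kappa>"
    using eventually_in_time eventually_small[OF sub \<delta>]
  proof eventually_elim
    case (elim t)
    let ?p = "pprt (S t h - h)" and ?n = "neg_part (S t h - h)"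
    have diff: "S (t + s) h - S s h = S s ?p - S s ?n"
    proof -
      have "S (t + s) h = S s (S t h)"
        using apply_add[OF s(1) elim(1), of h] by (simp only: add.commute[of t s])
      then have "S (t + s) h - S s h = S s (S t h - h)"
        by (simp add: blinfun.diff_right)
      also have "\<dots> = S s (?p - ?n)"
        by (simp only: pprt_minus_neg_part)
      finally show ?thesis
        by (simp only: blinfun.diff_right)
    qed
    then have "S (t + s) h + S s ?n = S s h + S s ?p"
      by (simp add: algebra_simps)
    then have "norm (S (t + s) h) + norm (S s ?n) = norm (S s h) + norm (S s ?p)"
      using norm_add_nonneg[OF positive[OF time_domain_add[OF J elim(1) s(1)] h]
          positive[OF s(1) neg_part_nonneg[of "S t h - h"]]]
        norm_add_nonneg[OF positive[OF s(1) h] positive[OF s(1) zero_le_pprt[of "S t h - h"]]]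
      by simp
    moreover have "norm (S s ?n) \<le> \<kappa> / 4"
      using norm_apply_le[OF s(1), of ?n] mult_left_mono[OF elim(2) M_nonneg] M\<delta> by linarith
    moreover have "norm (S (t + s) h) \<le> Sup A"
      using time_domain_add[OF J elim(1) s(1)] bdd by (auto simp: A_def intro: cSup_upper)
    moreover have "norm (S (t + s) h - S s h) \<le> norm (S s ?p) + norm (S s ?n)"
      unfolding diff by (rule norm_triangle_ineq4)
    ultimately show ?case
      using s(2) by linarith
  qed
  then show ?thesis
    using eventually_time_shift[OF J s(1), of "\<lambda>t. norm (S t h - S s h) \<le> \<kappa>"] by blast
qed

text \<open>In each step of the induction, either the bound \<open>L\<close> itself improves by the factor
  \<open>q = 1 - \<epsilon> / 4\<close>, or there is a time \<open>r\<close> at which the orbit has norm above \<open>q * L\<close>. Then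
  \<open>h = P (S r f)\<close> has norm at least \<open>\<epsilon> * q * L \<ge> (3 / 4) * \<epsilon> * L\<close>, and the orbit splits asymptotically into that
  of \<open>h\<close>, which is almost constant, and that of a vector \<open>g \<ge> 0\<close>, to which the induction hypothesis
  applies with the bound \<open>(1 - \<epsilon> / 2) * L\<close>. This bound is chosen between \<open>(1 - (3 / 4) * \<epsilon>) * L\<close> and \<open>q * L\<close>:
  the two gaps of size \<open>\<epsilon> * L / 4\<close> absorb the errors made before and after the induction hypothesis
  is used.\<close>

lemma lower_bound_orbit_oscillation:
  fixes P :: "'a \<Rightarrow> 'a" and \<epsilon> :: real
  assumes \<epsilon>: "0 < \<epsilon>" "\<epsilon> \<le> 1"
    and P_nonneg: "\<And>f. 0 \<le> f \<Longrightarrow> 0 \<le> P f"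
    and P_lower: "\<And>f. 0 \<le> f \<Longrightarrow> ((\<lambda>t. norm (neg_part (S t f - P f))) \<longlongrightarrow> 0) (at_top_in J)"
    and P_sub: "\<And>f. 0 \<le> f \<Longrightarrow> ((\<lambda>t. norm (neg_part (S t (P f) - P f))) \<longlongrightarrow> 0) (at_top_in J)"
    and P_norm: "\<And>f. 0 \<le> f \<Longrightarrow> \<epsilon> * norm f \<le> norm (P f)"
    and f: "0 \<le> f" and L: "0 < L" "\<forall>\<^sub>F t in at_top_in J. norm (S t f) \<le> L"
  shows "\<exists>c. \<forall>\<^sub>F t in at_top_in J. norm (S t f - c) \<le> (1 - \<epsilon> / 4) ^ n * L"
  using f L
proof (induction n arbitrary: f L)
  case 0
  then show ?case by (intro exI[of _ 0]) simp
next
  case (Suc n)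
  define q where "q = 1 - \<epsilon> / 4"
  have q: "0 < q" "q \<le> 1" "1 - \<epsilon> / 2 > 0" and q34: "3 / 4 \<le> q"
    using \<epsilon> by (auto simp: q_def)
  show ?case
  proof (cases "\<forall>\<^sub>F t in at_top_in J. norm (S t f) \<le> q * L")
    case True
    with Suc.IH[of f "q * L"] Suc.prems q show ?thesis
      by (simp add: q_def mult_ac)
  next
    case False
    then obtain r where r: "r \<in> J" "q * L < norm (S r f)"
      unfolding eventually_at_top_in by force
    define h where "h = P (S r f)"
    have Sr: "0 \<le> S r f" and h: "0 \<le> h"
      using P_nonneg positive r(1) Suc.prems(1) by (auto simp: h_def)
    have "3 / 4 * L \<le> norm (S r f)"
      using r(2) mult_right_mono[OF q34, of L] Suc.prems(2) by linarith
    then have "\<epsilon> * (3 / 4 * L) \<le> \<epsilon> * norm (S r f)"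
      using \<epsilon>(1) by (intro mult_left_mono) simp_all
    then have norm_h: "3 / 4 * \<epsilon> * L \<le> norm h"
      using P_norm[OF Sr] by (simp add: h_def)
    \<comment> \<open>The last estimate makes two errors of size \<open>\<delta>\<close>, and its gap is \<open>\<epsilon> * L / 4\<close> scaled by \<open>q ^ n\<close>.\<close>
    define \<delta> where "\<delta> = q ^ n * \<epsilon> * L / 8"
    have \<delta>: "0 < \<delta>"
      using q Suc.prems(2) \<epsilon> by (simp add: \<delta>_def)
    have "q ^ n * (\<epsilon> * L) \<le> 1 * (\<epsilon> * L)"
      using q \<epsilon> Suc.prems(2) by (intro mult_right_mono power_le_one) auto
    then have \<delta>_le: "\<delta> \<le> \<epsilon> * L / 8"
      by (simp add: \<delta>_def mult.assoc)
    have "0 < \<delta> / (M + 1)"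
      using \<delta> M_nonneg by simp
    from eventually_small[OF P_lower[OF Sr] this] eventually_in_time
    have "\<forall>\<^sub>F s in at_top_in J. norm (neg_part (S s (S r f) - h)) \<le> \<delta> / (M + 1) \<and> s \<in> J"
      unfolding h_def by (rule eventually_conj)
    then obtain s where s: "s \<in> J" "norm (neg_part (S s (S r f) - h)) \<le> \<delta> / (M + 1)"
      using eventually_happens'[OF at_top_in_neq_bot[OF J]] by blast
    have a: "s + r \<in> J"
      using time_domain_add[OF J s(1) r(1)] .
    define e where "e = neg_part (S (s + r) f - h)"
    define g where "g = pprt (S (s + r) f - h)"
    have e: "0 \<le> e" and g: "0 \<le> g" and ge: "g - e = S (s + r) f - h"
      by (simp_all add: e_def g_def neg_part_nonneg pprt_minus_neg_part)
    have Se: "norm (S t e) \<le> \<delta>" if "t \<in> J" for t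
    proof -
      have "M * norm e \<le> M * (\<delta> / (M + 1))"
        using s(2) M_nonneg by (intro mult_left_mono) (simp_all add: e_def apply_add s(1) r(1))
      also have "\<dots> \<le> \<delta>"
        using \<delta> M_nonneg by (simp add: field_simps)
      finally show ?thesis
        using norm_apply_le[OF that, of e] by linarith
    qed
    have split: "S (t + (s + r)) f = S t h + S t g - S t e" if "t \<in> J" for t
    proof -
      have "S t g - S t e = S t (S (s + r) f) - S t h"
        by (simp flip: blinfun.diff_right add: ge)
      then show ?thesis
        using apply_add[OF that a, of f] by (simp add: algebra_simps)
    qed
    have "\<forall>\<^sub>F t in at_top_in J. norm (S t g) \<le> (1 - \<epsilon> / 2) * L"
      using eventually_in_time eventually_small[OF P_sub[OF Sr] \<delta>]
        eventually_time_shift[OF J a, THEN iffD2, OF Suc.prems(3)]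
    proof eventually_elim
      case (elim t)
      note t = elim(1)
      have "S (t + (s + r)) f + S t e = S t h + S t g"
        using split[OF t] by simp
      then have "norm (S (t + (s + r)) f) + norm (S t e) = norm (S t h) + norm (S t g)"
        using norm_add_nonneg[OF positive[OF time_domain_add[OF J t a] Suc.prems(1)] positive[OF t e]]
          norm_add_nonneg[OF positive[OF t h] positive[OF t g]]
        by simp
      moreover have "norm h \<le> norm (S t h) + \<delta>"
      proof -
        have "h - S t h \<le> neg_part (S t h - h)"
          by (simp add: neg_part_def)
        then have "h \<le> S t h + neg_part (S t h - h)"
          by (simp add: diff_le_eq add.commute)
        then have "norm h \<le> norm (S t h + neg_part (S t h - h))"
          using norm_mono_nonneg h by blast
        also have "\<dots> \<le> norm (S t h) + norm (neg_part (S t h - h))"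
          by (rule norm_triangle_ineq)
        finally show ?thesis
          using elim(2) by (simp add: h_def)
      qed
      ultimately have "norm (S t g) \<le> L + 2 * \<delta> - 3 / 4 * \<epsilon> * L"
        using elim(3) Se[OF t] norm_h by linarith
      also have "\<dots> \<le> (1 - \<epsilon> / 2) * L"
        using \<delta>_le by (simp add: algebra_simps)
      finally show ?case .
    qed
    from Suc.IH[OF g _ this]
    obtain c where c: "\<forall>\<^sub>F t in at_top_in J. norm (S t g - c) \<le> q ^ n * ((1 - \<epsilon> / 2) * L)"
      using q Suc.prems(2) unfolding q_def by auto
    obtain d where d: "\<forall>\<^sub>F t in at_top_in J. norm (S t h - d) \<le> \<delta>"
      using subinvariant_orbit_almost_constant[OF h _ \<delta>] P_sub[OF Sr] unfolding h_def by blast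
    have "\<forall>\<^sub>F t in at_top_in J. norm (S (t + (s + r)) f - (c + d)) \<le> q ^ Suc n * L"
      using eventually_in_time c d
    proof eventually_elim
      case (elim t)
      have "S (t + (s + r)) f - (c + d) = (S t g - c) + (S t h - d) - S t e"
        using split[OF elim(1)] by (simp add: algebra_simps)
      also have "norm \<dots> \<le> norm (S t g - c) + norm (S t h - d) + norm (S t e)"
        by (meson add_right_mono norm_triangle_ineq norm_triangle_ineq4 order_trans)
      also have "\<dots> \<le> q ^ n * ((1 - \<epsilon> / 2) * L) + \<delta> + \<delta>"
        using elim Se by (meson add_mono)
      also have "\<dots> = q ^ Suc n * L"
        by (simp add: \<delta>_def q_def algebra_simps)
      finally show ?case .
    qed
    then show ?thesis
      using eventually_time_shift[OF J a, of "\<lambda>t. norm (S t f - (c + d)) \<le> q ^ Suc n * L"]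
      unfolding q_def by blast
  qed
qed

lemma almost_constant_orbit_convergent:
  assumes "\<And>\<kappa>. 0 < \<kappa> \<Longrightarrow> \<exists>c. \<forall>\<^sub>F t in at_top_in J. norm (S t f - c) \<le> \<kappa>"
  shows "\<exists>l. ((\<lambda>t. S t f) \<longlongrightarrow> l) (at_top_in J)"
proof -
  have "cauchy_filter (filtermap (\<lambda>t. S t f) (at_top_in J))"
    unfolding cauchy_filter_metric_filtermap
  proof (intro allI impI)
    fix \<kappa> :: real
    assume "0 < \<kappa>"
    then obtain c where c: "\<forall>\<^sub>F t in at_top_in J. norm (S t f - c) \<le> \<kappa> / 3"
      using assms[of "\<kappa> / 3"] by auto
    have "dist (S s f) (S t f) < \<kappa>"
      if "norm (S s f - c) \<le> \<kappa> / 3" "norm (S t f - c) \<le> \<kappa> / 3" for s t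
      using dist_triangle2[of "S s f" "S t f" c] that \<open>0 < \<kappa>\<close> by (simp add: dist_norm)
    with c show "\<exists>X. eventually X (at_top_in J) \<and> (\<forall>s t. X s \<and> X t \<longrightarrow> dist (S s f) (S t f) < \<kappa>)"
      by blast
  qed
  moreover have "filtermap (\<lambda>t. S t f) (at_top_in J) \<noteq> bot"
    using at_top_in_neq_bot[OF J] by (simp add: filtermap_bot_iff)
  ultimately show ?thesis
    using complete_UNIV[where 'a = 'a] unfolding complete_uniform filterlim_def by simp
qed

lemma strongly_convergentI:
  assumes "\<And>f. 0 \<le> f \<Longrightarrow> \<exists>l. ((\<lambda>t. S t f) \<longlongrightarrow> l) (at_top_in J)"
  shows "strongly_convergent J S"
proof -
  have "\<exists>l. ((\<lambda>t. S t f) \<longlongrightarrow> l) (at_top_in J)" for f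
  proof -
    obtain k l where "((\<lambda>t. S t (pprt f)) \<longlongrightarrow> k) (at_top_in J)"
      "((\<lambda>t. S t (neg_part f)) \<longlongrightarrow> l) (at_top_in J)"
      using assms[of "pprt f"] assms[of "neg_part f"] neg_part_nonneg by auto
    then have "((\<lambda>t. S t (pprt f) - S t (neg_part f)) \<longlongrightarrow> k - l) (at_top_in J)"
      by (rule tendsto_diff)
    then show ?thesis
      by (auto simp: pprt_minus_neg_part simp flip: blinfun.diff_right)
  qed
  then obtain Q where Q: "\<And>f. ((\<lambda>t. S t f) \<longlongrightarrow> Q f) (at_top_in J)"
    by metis
  note unique = tendsto_unique[OF at_top_in_neq_bot[OF J]]
  have "bounded_linear Q"
  proof (rule bounded_linear_intro[where K = M])
    show "Q (x + y) = Q x + Q y" for x y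
      using unique[OF Q] tendsto_add[OF Q Q] by (simp add: blinfun.add_right)
    show "Q (c *\<^sub>R x) = c *\<^sub>R Q x" for c x
      using unique[OF Q] tendsto_scaleR[OF tendsto_const Q] by (simp add: blinfun.scaleR_right)
    show "norm (Q x) \<le> norm x * M" for x
    proof (rule tendsto_upperbound[OF tendsto_norm[OF Q] _ at_top_in_neq_bot[OF J]])
      show "\<forall>\<^sub>F t in at_top_in J. norm (S t x) \<le> norm x * M"
        using eventually_in_time by eventually_elim (metis norm_apply_le mult.commute)
    qed
  qed
  then show ?thesis
    using Q unfolding strongly_convergent_def strong_limit_def
    by (intro exI[of _ "Blinfun Q"]) (simp add: bounded_linear_Blinfun_apply)
qed

text \<open>The iteration of \<open>lower_bound_orbit_oscillation\<close> starts with \<open>L\<close> from the boundedness of the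
  semigroup and is run until \<open>(1 - \<epsilon> / 4) ^ n * L\<close> is below the prescribed accuracy. \<open>P\<close> only
  selects a lower bound for each orbit.\<close>

theorem lower_bound_strongly_convergent:
  fixes P :: "'a \<Rightarrow> 'a" and \<epsilon> :: real
  assumes \<epsilon>: "0 < \<epsilon>"
    and P_nonneg: "\<And>f. 0 \<le> f \<Longrightarrow> 0 \<le> P f"
    and P_lower: "\<And>f. 0 \<le> f \<Longrightarrow> ((\<lambda>t. norm (neg_part (S t f - P f))) \<longlongrightarrow> 0) (at_top_in J)"
    and P_sub: "\<And>f. 0 \<le> f \<Longrightarrow> ((\<lambda>t. norm (neg_part (S t (P f) - P f))) \<longlongrightarrow> 0) (at_top_in J)"
    and P_norm: "\<And>f. 0 \<le> f \<Longrightarrow> \<epsilon> * norm f \<le> norm (P f)"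
  shows "strongly_convergent J S"
proof (intro strongly_convergentI almost_constant_orbit_convergent)
  fix f :: 'a and \<kappa> :: real
  assume f: "0 \<le> f" and \<kappa>: "0 < \<kappa>"
  \<comment> \<open>A lower bound with \<open>\<epsilon> > 1\<close> may be weakened to \<open>1\<close>; this keeps the contraction factor in \<open>(0, 1)\<close>.\<close>
  define \<eta> where "\<eta> = min \<epsilon> 1"
  have \<eta>: "0 < \<eta>" "\<eta> \<le> 1"
    using \<epsilon> by (auto simp: \<eta>_def)
  have \<eta>_norm: "\<eta> * norm x \<le> norm (P x)" if "0 \<le> x" for x
    using P_norm[OF that] mult_right_mono[of \<eta> \<epsilon> "norm x"] by (simp add: \<eta>_def)
  \<comment> \<open>Adding \<open>1\<close> keeps \<open>L\<close> positive when \<open>f = 0\<close> or \<open>M = 0\<close>.\<close>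
  define L where "L = M * norm f + 1"
  have L: "0 < L"
    using M_nonneg by (simp add: L_def add_nonneg_pos)
  have L_bound: "\<forall>\<^sub>F t in at_top_in J. norm (S t f) \<le> L"
    using eventually_in_time
  proof eventually_elim
    case (elim t)
    then show ?case using norm_apply_le[of t f] by (simp add: L_def)
  qed
  have "0 < \<kappa> / L" "1 - \<eta> / 4 < 1"
    using \<kappa> L \<eta> by simp_all
  then obtain n where "(1 - \<eta> / 4) ^ n < \<kappa> / L"
    using real_arch_pow_inv by blast
  then have n: "(1 - \<eta> / 4) ^ n * L \<le> \<kappa>"
    using L by (simp add: field_simps)
  obtain c where "\<forall>\<^sub>F t in at_top_in J. norm (S t f - c) \<le> (1 - \<eta> / 4) ^ n * L"
    using lower_bound_orbit_oscillation[OF \<eta> P_nonneg P_lower P_sub \<eta>_norm f L L_bound] by blast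
  with n show "\<exists>c. \<forall>\<^sub>F t in at_top_in J. norm (S t f - c) \<le> \<kappa>"
    by (auto intro!: exI[of _ c] elim: eventually_mono)
qed

lemma strong_limit_nonneg:
  assumes "strong_limit J S P" "0 \<le> f"
  shows "0 \<le> P f"
proof (rule nonneg_limit[OF at_top_in_neq_bot[OF J]])
  show "((\<lambda>t. S t f) \<longlongrightarrow> P f) (at_top_in J)"
    using assms(1) by (simp add: strong_limit_def)
  show "\<forall>\<^sub>F t in at_top_in J. 0 \<le> S t f"
    using eventually_in_time by eventually_elim (use positive assms(2) in blast)
qed

text \<open>Both \<open>S t (P f)\<close> and \<open>P f\<close> are limits of \<open>S t (S s f) = S (s + t) f\<close> as \<open>s\<close> tends to infinity.\<close>

lemma strong_limit_fixed:
  assumes P: "strong_limit J S P" and t: "t \<in> J"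
  shows "S t (P f) = P f"
proof -
  have lim: "((\<lambda>s. S s f) \<longlongrightarrow> P f) (at_top_in J)"
    using P by (simp add: strong_limit_def)
  have "((\<lambda>s. S (s + t) f) \<longlongrightarrow> P f) (at_top_in J)"
  proof (rule tendstoI)
    fix \<delta> :: real
    assume "0 < \<delta>"
    with lim have "\<forall>\<^sub>F s in at_top_in J. dist (S s f) (P f) < \<delta>"
      by (rule tendstoD)
    then show "\<forall>\<^sub>F s in at_top_in J. dist (S (s + t) f) (P f) < \<delta>"
      using eventually_time_shift[OF J t, of "\<lambda>s. dist (S s f) (P f) < \<delta>"] by simp
  qed
  moreover have "\<forall>\<^sub>F s in at_top_in J. S (s + t) f = S t (S s f)"
    using eventually_in_time by eventually_elim (simp add: add.commute[of _ t] apply_add[OF t])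
  ultimately have "((\<lambda>s. S t (S s f)) \<longlongrightarrow> P f) (at_top_in J)"
    using tendsto_cong by fast
  moreover have "((\<lambda>s. S t (S s f)) \<longlongrightarrow> S t (P f)) (at_top_in J)"
    by (rule bounded_linear.tendsto[OF blinfun.bounded_linear_right lim])
  ultimately show ?thesis
    using tendsto_unique[OF at_top_in_neq_bot[OF J]] by blast
qed

end

lemma bounded_positive_semigroup_intro:
  assumes "J = discrete_time \<or> J = continuous_time"
    and "op_semigroup_on J S" "bounded_op_family J S" "positive_op_family J S"
  shows "\<exists>M. bounded_positive_semigroup J S M"
proof -
  obtain M where "\<And>t. t \<in> J \<Longrightarrow> norm (S t) \<le> M"
    using assms(3) unfolding bounded_op_family_def bdd_above_def by blast
  then have "bounded_positive_semigroup J S M"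
    using assms unfolding op_semigroup_on_def positive_op_family_def
    by unfold_locales (auto simp: time_domain_def)
  then show ?thesis ..
qed

theorem corollary4p6:
  fixes S T :: "real \<Rightarrow> 'a::al_space \<Rightarrow>\<^sub>L 'a"
    and P :: "'a \<Rightarrow>\<^sub>L 'a"
    and J :: "real set"
    and \<epsilon> :: real
  assumes "J = discrete_time \<or> J = continuous_time"
    and "op_semigroup_on J S" and "bounded_op_family J S" and "positive_op_family J S"
    and "op_semigroup_on J T" and "bounded_op_family J T" and "positive_op_family J T"
    and "asymptotically_dominates J S T"
    and "strong_limit J T P"
    and "\<epsilon> > 0" and "\<And>f. 0 \<le> f \<Longrightarrow> norm (blinfun_apply P f) \<ge> \<epsilon> * norm f"
  shows "strongly_convergent J S"
proof -
  obtain M N where "bounded_positive_semigroup J S M" "bounded_positive_semigroup J T N"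
    using assms(1-7) bounded_positive_semigroup_intro by metis
  then interpret S: bounded_positive_semigroup J S M + T: bounded_positive_semigroup J T N .
  have dom: "((\<lambda>t. norm (neg_part (S t f - T t f))) \<longlongrightarrow> 0) (at_top_in J)" if "0 \<le> f" for f
    using assms(8) that by (simp add: asymptotically_dominates_def)
  note P_nonneg = T.strong_limit_nonneg[OF assms(9)]
  show ?thesis
  proof (rule S.lower_bound_strongly_convergent[OF assms(10) P_nonneg _ _ assms(11)])
    fix f :: 'a
    assume f: "0 \<le> f"
    have "((\<lambda>t. T t f - P f) \<longlongrightarrow> 0) (at_top_in J)"
      using assms(9) by (simp add: strong_limit_def LIM_zero)
    from tendsto_add[OF dom[OF f] tendsto_norm[OF this]]
    have lim: "((\<lambda>t. norm (neg_part (S t f - T t f)) + norm (T t f - P f)) \<longlongrightarrow> 0) (at_top_in J)"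
      by simp
    have "norm (neg_part (S t f - P f)) \<le> norm (neg_part (S t f - T t f)) + norm (T t f - P f)" for t
      using norm_neg_part_add_le[of "S t f - T t f" "T t f - P f"] norm_neg_part_le[of "T t f - P f"]
      by simp
    then show "((\<lambda>t. norm (neg_part (S t f - P f))) \<longlongrightarrow> 0) (at_top_in J)"
      by (intro tendsto_sandwich[OF _ _ tendsto_const lim]) simp_all
    have "\<forall>\<^sub>F t in at_top_in J.
        norm (neg_part (S t (P f) - T t (P f))) = norm (neg_part (S t (P f) - P f))"
      using eventually_in_time by eventually_elim (simp add: T.strong_limit_fixed[OF assms(9)])
    then show "((\<lambda>t. norm (neg_part (S t (P f) - P f))) \<longlongrightarrow> 0) (at_top_in J)"
      using dom[OF P_nonneg[OF f]] tendsto_cong by fast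
  qed
qed

end
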